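(* Let $n,m$ be positive integers. There exists a variable-weight perfect $(n\times m,\{3,4\},1)$-GOC if and only if $n\equiv m\equiv 0\pmod 3$ or $n\equiv m\equiv 1\pmod 3$.
   Context: For a finite set $B\subset\mathbb{Z}\times\mathbb{Z}$ and $(s,t)\in\mathbb{Z}\times\mathbb{Z}$, put $B+(s,t)=\{(x+s,y+t):(x,y)\in B\}$, and let $\Delta B$ be the multiset of differences $(x_1-x_2,y_1-y_2)$ over ordered pairs of distinct elements of $B$. Let $n,m$ be positive integers and $K$ a set of positive integers. An $(n\times m,K,1)$-geometric orthogonal code (GOC) is a (possibly empty) collection $\mathcal{C}$ of subsets (codewords) of $\{0,1,\dots,n-1\}\times\{0,1,\dots,m-1\}$ with sizes in $K$ such that (1) $|B\cap(B+(s,t))|\le 1$ for all $B\in\mathcal{C}$ and all $(s,t)\in\mathbb{Z}^2\setminus\{(0,0)\}$; (2) $|A\cap(B+(s,t))|\le 1$ for all $A\ne B$ in $\mathcal{C}$ and all $(s,t)\in\mathbb{Z}^2$. For odd $a$, $[a]=\{-\frac{a-1}{2},\dots,\frac{a-1}{2}\}$. The code is perfect if the multiset union $\Delta\mathcal{C}=\bigcup_{B\in\mathcal{C}}\Delta B$ equals $([2n-1]\times[2m-1])\setminus\{(0,0)\}$, each element occurring exactly once. "Variable-weight" means only that $|K|>1$; not every element of $K$ needs to occur as a codeword size. *)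

theory Defs
  imports "HOL-Library.Multiset" "HOL-Number_Theory.Cong"
begin

definition translate :: "(int \<times> int) set \<Rightarrow> int \<times> int \<Rightarrow> (int \<times> int) set" where
  "translate B v = (\<lambda>(x, y). (x + fst v, y + snd v)) ` B"

definition differences :: "(int \<times> int) set \<Rightarrow> (int \<times> int) multiset" where
  "differences B =
     image_mset (\<lambda>((x1, y1), (x2, y2)). (x1 - x2, y1 - y2))
       (mset_set {(p, q). p \<in> B \<and> q \<in> B \<and> p \<noteq> q})"

text \<open>Multiset union counts multiplicities additively, so it is the sum of multisets. The sum is
  only meaningful for finite collections; every code below is a subset of the finite set
  \<open>Pow ({0..<n} \<times> {0..<m})\<close>.\<close>

definition code_differences :: "(int \<times> int) set set \<Rightarrow> (int \<times> int) multiset" where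
  "code_differences C = (\<Sum>B\<in>C. differences B)"

text \<open>The set written \<open>[a]\<close> in the literature; intended for odd \<open>a\<close> only, where the division is exact.\<close>

definition centered_interval :: "int \<Rightarrow> int set" where
  "centered_interval a = {- ((a - 1) div 2)..(a - 1) div 2}"

definition geometric_orthogonal_code ::
    "nat \<Rightarrow> nat \<Rightarrow> nat set \<Rightarrow> (int \<times> int) set set \<Rightarrow> bool" where
  "geometric_orthogonal_code n m K C \<longleftrightarrow>
     0 < n \<and> 0 < m \<and> (\<forall>k\<in>K. 0 < k) \<and>
     (\<forall>B\<in>C. B \<subseteq> {0..<int n} \<times> {0..<int m} \<and> card B \<in> K) \<and>
     (\<forall>B\<in>C. \<forall>v. v \<noteq> (0, 0) \<longrightarrow> card (B \<inter> translate B v) \<le> 1) \<and>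
     (\<forall>A\<in>C. \<forall>B\<in>C. A \<noteq> B \<longrightarrow> (\<forall>v. card (A \<inter> translate B v) \<le> 1))"

definition perfect_goc :: "nat \<Rightarrow> nat \<Rightarrow> nat set \<Rightarrow> (int \<times> int) set set \<Rightarrow> bool" where
  "perfect_goc n m K C \<longleftrightarrow>
     geometric_orthogonal_code n m K C \<and>
     code_differences C =
       mset_set (centered_interval (2 * int n - 1) \<times> centered_interval (2 * int m - 1) - {(0, 0)})"

text \<open>Variable weight is a condition on \<open>K\<close> alone (\<open>K\<close> has more than one element, possibly
  infinitely many); not every element of \<open>K\<close> has to be the size of a codeword.\<close>

definition variable_weight :: "nat set \<Rightarrow> bool" where
  "variable_weight K \<longleftrightarrow> (\<exists>k\<in>K. \<exists>l\<in>K. k \<noteq> l)"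

end

theory Submission
  imports Defs "HOL-Library.Product_Plus"
begin

text \<open>
  Necessity: a codeword of size 3 or 4 has 6 or 12 differences, so 6 divides \<open>(2n - 1)(2m - 1) - 1\<close>.

  Sufficiency: translating codewords does not change differences, so it suffices to decompose the
  punctured box \<open>[2n - 1] \<times> [2m - 1] - {(0, 0)}\<close> into difference sets of blocks of size 3 or 4.
  If \<open>n \<equiv> m \<equiv> 1\<close>, both axes \<open>[2n - 1] - {0}\<close> and \<open>[2m - 1] - {0}\<close> are decomposable, by Skolem-type
  sequences together with at most one block of size 4, and the product of two decomposable sets is
  decomposable because of the sharply 2-transitive groups \<open>S3\<close> and \<open>A4\<close>.
  If \<open>n \<equiv> m \<equiv> 0\<close>, rows are added to a stretched smaller box: three rows at heights \<open>a\<close>, \<open>b\<close>, \<open>a + b\<close>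
  (and their negatives) decompose by means of an additive permutation of \<open>[2n - 1]\<close>. Doing this in
  both directions leaves the boxes with \<open>n, m \<in> {3, 6}\<close>. In both cases the numbers \<open>1..M\<close> without the
  stretched part have to be split into triples \<open>a\<close>, \<open>b\<close>, \<open>a + b\<close>; for \<open>M = 4L\<close> and \<open>M = 4L + 3\<close> the odd
  numbers and the upper part do this and leave \<open>2, 4, .., 2L\<close>.
\<close>

section \<open>Difference sets and decompositions\<close>

definition Delta :: "'a::ab_group_add list \<Rightarrow> 'a set" where
  "Delta B = {p - q |p q. p \<in> set B \<and> q \<in> set B \<and> p \<noteq> q}"

text \<open>The number of ordered pairs of distinct positions. \<open>Delta\<close> is a plain set,
  so multiplicities are controlled through this count alone.\<close>

definition weight :: "'a list \<Rightarrow> nat" where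
  "weight B = length B * (length B - 1)"

text \<open>The blocks of a decomposition cover \<open>D\<close> by their differences, and there are too few differences
  for a repetition; so each element of \<open>D\<close> occurs exactly once. In this form only the covering
  has to be checked.\<close>

definition decomposable :: "nat set \<Rightarrow> 'a::ab_group_add set \<Rightarrow> bool" where
  "decomposable K D \<longleftrightarrow> finite D \<and>
     (\<exists>Bs. (\<forall>B\<in>set Bs. distinct B \<and> length B \<in> K) \<and> D \<subseteq> (\<Union>B\<in>set Bs. Delta B) \<and>
       (\<Sum>B\<leftarrow>Bs. weight B) \<le> card D)"

lemma decomposableI:
  assumes "finite D" "\<And>B. B \<in> set Bs \<Longrightarrow> distinct B \<and> length B \<in> K"
    "\<And>d. d \<in> D \<Longrightarrow> \<exists>B\<in>set Bs. d \<in> Delta B" "(\<Sum>B\<leftarrow>Bs. weight B) \<le> card D"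
  shows "decomposable K D"
  unfolding decomposable_def
proof (intro conjI exI[of _ Bs])
  show "D \<subseteq> (\<Union>B\<in>set Bs. Delta B)" using assms(3) by auto
qed (use assms in auto)

lemma decomposableE:
  assumes "decomposable K D"
  obtains Bs where "finite D" "\<And>B. B \<in> set Bs \<Longrightarrow> distinct B \<and> length B \<in> K"
    "\<And>d. d \<in> D \<Longrightarrow> \<exists>B\<in>set Bs. d \<in> Delta B" "(\<Sum>B\<leftarrow>Bs. weight B) \<le> card D"
proof -
  from assms obtain Bs where Bs: "finite D" "\<forall>B\<in>set Bs. distinct B \<and> length B \<in> K"
    "D \<subseteq> (\<Union>B\<in>set Bs. Delta B)" "(\<Sum>B\<leftarrow>Bs. weight B) \<le> card D"
    unfolding decomposable_def by auto
  show thesis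
  proof (rule that[of Bs])
    show "\<exists>B\<in>set Bs. d \<in> Delta B" if "d \<in> D" for d using that Bs(3) by auto
  qed (use Bs in auto)
qed

lemma DeltaI: "p \<in> set B \<Longrightarrow> q \<in> set B \<Longrightarrow> p \<noteq> q \<Longrightarrow> p - q \<in> Delta B"
  by (auto simp: Delta_def)

lemma DeltaI2: "p \<in> set B \<Longrightarrow> q \<in> set B \<Longrightarrow> p \<noteq> q \<Longrightarrow> d = p - q \<Longrightarrow> d \<in> Delta B"
  by (auto simp: Delta_def)

lemma DeltaE:
  assumes "d \<in> Delta B"
  obtains i j where "i < length B" "j < length B" "i \<noteq> j" "d = B ! i - B ! j"
  using assms by (auto simp: Delta_def in_set_conv_nth)

lemma Delta_uminus: "- d \<in> Delta B \<longleftrightarrow> d \<in> Delta B"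
proof -
  have "- d \<in> Delta B" if d: "d \<in> Delta B" for d
  proof -
    obtain p q where "p \<in> set B" "q \<in> set B" "p \<noteq> q" "d = p - q" using d by (auto simp: Delta_def)
    then show ?thesis by (intro DeltaI2[of q _ p]) auto
  qed
  from this[of d] this[of "- d"] show ?thesis by (metis minus_minus)
qed

lemma decomposable_mono: "decomposable K D \<Longrightarrow> K \<subseteq> K' \<Longrightarrow> decomposable K' D"
  unfolding decomposable_def by (meson subsetD)

lemma decomposable_empty: "decomposable K {}"
  by (rule decomposableI[where Bs = "[]"]) auto

lemma decomposable_Un:
  assumes "decomposable K D" "decomposable K E" "D \<inter> E = {}"
  shows "decomposable K (D \<union> E)"
proof -
  obtain Bs where 1: "finite D" "\<And>B. B \<in> set Bs \<Longrightarrow> distinct B \<and> length B \<in> K"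
    "\<And>d. d \<in> D \<Longrightarrow> \<exists>B\<in>set Bs. d \<in> Delta B" "(\<Sum>B\<leftarrow>Bs. weight B) \<le> card D"
    using decomposableE[OF assms(1)] by blast
  obtain Cs where 2: "finite E" "\<And>B. B \<in> set Cs \<Longrightarrow> distinct B \<and> length B \<in> K"
    "\<And>d. d \<in> E \<Longrightarrow> \<exists>B\<in>set Cs. d \<in> Delta B" "(\<Sum>B\<leftarrow>Cs. weight B) \<le> card E"
    using decomposableE[OF assms(2)] by blast
  show ?thesis
  proof (rule decomposableI)
    show "\<exists>B\<in>set (Bs @ Cs). d \<in> Delta B" if "d \<in> D \<union> E" for d
    proof (cases "d \<in> D")
      case True
      then show ?thesis using 1(3)[of d] by auto
    next
      case False
      then show ?thesis using that 2(3)[of d] by auto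
    qed
    show "(\<Sum>B\<leftarrow>Bs @ Cs. weight B) \<le> card (D \<union> E)"
      using 1 2 assms(3) by (simp add: card_Un_disjoint)
  qed (use 1 2 in auto)
qed

text \<open>Blocks map to blocks of the same size. Stretching, swapping coordinates and embedding an
  axis are all instances.\<close>

lemma decomposable_image:
  assumes "decomposable K D" "inj f" "\<And>x y. f (x - y) = f x - f y"
  shows "decomposable K (f ` D)"
proof -
  obtain Bs where 1: "finite D" "\<And>B. B \<in> set Bs \<Longrightarrow> distinct B \<and> length B \<in> K"
    "\<And>d. d \<in> D \<Longrightarrow> \<exists>B\<in>set Bs. d \<in> Delta B" "(\<Sum>B\<leftarrow>Bs. weight B) \<le> card D"
    using decomposableE[OF assms(1)] by blast
  show ?thesis
  proof (rule decomposableI[where Bs = "map (map f) Bs"])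
    show "finite (f ` D)" using 1 by simp
    show "distinct B \<and> length B \<in> K" if "B \<in> set (map (map f) Bs)" for B
      using that 1(2) inj_on_subset[OF assms(2) subset_UNIV] by (auto simp: distinct_map)
    show "\<exists>B\<in>set (map (map f) Bs). d \<in> Delta B" if d: "d \<in> f ` D" for d
    proof -
      obtain e where e: "e \<in> D" "d = f e" using d by auto
      then obtain B where B: "B \<in> set Bs" "e \<in> Delta B" using 1(3) by blast
      then obtain p q where "p \<in> set B" "q \<in> set B" "p \<noteq> q" "e = p - q"
        by (auto simp: Delta_def)
      then have "d \<in> Delta (map f B)"
        using assms(2,3) e by (intro DeltaI2[of "f p" _ "f q"]) (auto dest: injD)
      then show ?thesis using B by auto
    qed
    show "(\<Sum>B\<leftarrow>map (map f) Bs. weight B) \<le> card (f ` D)"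
      using 1(4) card_image[OF inj_on_subset[OF assms(2) subset_UNIV], of D]
      by (simp add: o_def weight_def)
  qed
qed

section \<open>Products of decomposable sets\<close>

text \<open>\<open>S3\<close> and \<open>A4\<close> are the sharply 2-transitive permutation groups of degrees 3 and 4.\<close>

definition sharply2 :: "nat \<Rightarrow> nat list list" where
  "sharply2 k = (if k = 3
     then [[0,1,2],[0,2,1],[1,0,2],[1,2,0],[2,0,1],[2,1,0]]
     else [[0,1,2,3],[0,2,3,1],[0,3,1,2],[1,0,3,2],[1,2,0,3],[1,3,2,0],
           [2,0,1,3],[2,1,3,0],[2,3,0,1],[3,0,2,1],[3,1,0,2],[3,2,1,0]])"

text \<open>Evaluated over all indices. As the list has \<open>k * (k - 1)\<close> members, the
  member sending one given pair of indices to another is unique.\<close>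

lemma sharply2_transitive:
  assumes "k = 3 \<or> k = 4" "i < k" "i' < k" "j < k" "j' < k" "i \<noteq> i'" "j \<noteq> j'"
  shows "\<exists>f\<in>set (sharply2 k). f ! i = j \<and> f ! i' = j'"
proof -
  let ?P = "\<lambda>k. list_all (\<lambda>i. list_all (\<lambda>i'. i = i' \<or> list_all (\<lambda>j. list_all (\<lambda>j'. j = j' \<or>
    list_ex (\<lambda>f. f ! i = j \<and> f ! i' = j') (sharply2 k)) [0..<k]) [0..<k]) [0..<k]) [0..<k]"
  have *: "[0..<3] = [0,1,2]" "[0..<4] = [0,1,2,3]" by (simp_all add: upt_rec)
  have "?P 3" "?P 4" unfolding * by (simp_all add: sharply2_def)
  then have "?P k" using assms(1) by blast
  then show ?thesis using assms(2-) unfolding list_all_iff list_ex_iff by (metis atLeastLessThan_iff le0 set_upt)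
qed

lemma length_sharply2: "k = 3 \<or> k = 4 \<Longrightarrow> length (sharply2 k) = k * (k - 1)"
  by (auto simp: sharply2_def)

text \<open>The weights make the family exactly as large as the pairs of differences, counted with
  multiplicity.\<close>

definition product_family ::
    "'a::ab_group_add list \<Rightarrow> 'b::ab_group_add list \<Rightarrow> ('a \<times> 'b) list list \<Rightarrow> bool" where
  "product_family B C Es \<longleftrightarrow> (\<forall>E\<in>set Es. distinct E \<and> length E \<in> {3,4}) \<and>
    (\<forall>x\<in>Delta B. \<forall>y\<in>Delta C. \<exists>E\<in>set Es. (x, y) \<in> Delta E) \<and>
    (\<Sum>E\<leftarrow>Es. weight E) = weight B * weight C"

text \<open>Superimposing two blocks along all injections of the index set of the smaller one that extend to
  members of a sharply 2-transitive set pairs every difference with every difference exactly once.\<close>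

lemma product_family_exists_le:
  assumes "k = 3 \<or> k = 4" "l = 3 \<or> l = 4" "length B = k" "length C = l" "distinct B" "distinct C" "k \<le> l"
  shows "\<exists>Bs. product_family B C Bs"
proof -
  \<comment> \<open>Only the first \<open>k\<close> entries of \<open>f\<close> are read, so for
    \<open>k < l\<close> a member of \<open>sharply2 l\<close> acts as an injection of
    indices.\<close>
  define E where "E f = map (\<lambda>i. (B ! i, C ! (f ! i))) [0..<k]" for f
  have len: "length (E f) = k" for f by (simp add: E_def)
  have E: "distinct (E f)" for f
    unfolding E_def distinct_map
    using assms(3,5) by (auto intro!: inj_onI simp: nth_eq_iff_index_eq)
  show ?thesis unfolding product_family_def
  proof (intro exI[of _ "map E (sharply2 l)"] conjI ballI)
    fix F assume "F \<in> set (map E (sharply2 l))"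
    then show "length F \<in> {3,4}" using len assms(1) by auto
    show "distinct F" using \<open>F \<in> _\<close> E by auto
  next
    fix x y assume "x \<in> Delta B" "y \<in> Delta C"
    then obtain i i' j j' where *: "i < k" "i' < k" "i \<noteq> i'" "x = B ! i - B ! i'"
       "j < l" "j' < l" "j \<noteq> j'" "y = C ! j - C ! j'"
      using assms(3,4) by (auto elim!: DeltaE)
    then obtain f where f: "f \<in> set (sharply2 l)" "f ! i = j" "f ! i' = j'"
      using sharply2_transitive[of l i i' j j'] assms by auto
    have "(x, y) \<in> Delta (E f)"
    proof (rule DeltaI2[of "E f ! i" _ "E f ! i'"])
      show "E f ! i \<noteq> E f ! i'" using * assms by (simp add: E_def nth_eq_iff_index_eq)
      show "(x, y) = E f ! i - E f ! i'" using * f by (simp add: E_def)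
    qed (use * len in auto)
    then show "\<exists>E\<in>set (map E (sharply2 l)). (x, y) \<in> Delta E" using f by auto
  next
    \<comment> \<open>There are \<open>l * (l - 1)\<close> blocks, each of weight
      \<open>k * (k - 1)\<close>.\<close>
    show "(\<Sum>E\<leftarrow>map E (sharply2 l). weight E) = weight B * weight C"
      using assms by (simp add: o_def weight_def len sum_list_triv length_sharply2)
  qed
qed

lemma Delta_swap: "(x, y) \<in> Delta E \<Longrightarrow> (y, x) \<in> Delta (map prod.swap E)"
  unfolding Delta_def
  apply clarsimp
  subgoal for a b c d
    by (rule exI[of _ b], rule exI[of _ a], rule exI[of _ d], rule conjI, simp, rule exI[of _ c]) force
  done

text \<open>The injections lead from the shorter block to the longer one; in the other case the
  coordinates are swapped.\<close>

lemma product_family_exists: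
  assumes "length B \<in> {3,4}" "length C \<in> {3,4}" "distinct B" "distinct C"
  shows "\<exists>Bs. product_family B C Bs"
proof (cases "length B \<le> length C")
  case True
  then show ?thesis using product_family_exists_le[of "length B" "length C" B C] assms by auto
next
  case False
  then obtain Bs where Bs: "\<forall>B\<in>set Bs. distinct B \<and> length B \<in> {3,4}"
    "\<forall>x\<in>Delta C. \<forall>y\<in>Delta B. \<exists>E\<in>set Bs. (x, y) \<in> Delta E" "(\<Sum>E\<leftarrow>Bs. weight E) = weight C * weight B"
    using product_family_exists_le[of "length C" "length B" C B] assms unfolding product_family_def by auto
  show ?thesis unfolding product_family_def
  proof (intro exI[of _ "map (map prod.swap) Bs"] conjI ballI)
    fix x y assume "x \<in> Delta B" "y \<in> Delta C"
    then obtain E where "E \<in> set Bs" "(y, x) \<in> Delta E" using Bs(2) by blast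
    then show "\<exists>E\<in>set (map (map prod.swap) Bs). (x, y) \<in> Delta E"
      using Delta_swap[of y x E] by auto
  qed (use Bs in \<open>auto simp: distinct_map o_def weight_def mult.commute\<close>)
qed

lemma sum_list_map_concat: "(\<Sum>x\<leftarrow>concat xss. f x) = (\<Sum>xs\<leftarrow>xss. \<Sum>x\<leftarrow>xs. f x)"
  by (induction xss) auto

text \<open>Each pair of blocks gets its product family, so the total weight is the product of both
  total weights.\<close>

lemma decomposable_Times:
  assumes "decomposable {3,4} X" "decomposable {3,4} Y"
  shows "decomposable {3,4} (X \<times> Y)"
proof -
  obtain Bs where 1: "finite X" "\<And>B. B \<in> set Bs \<Longrightarrow> distinct B \<and> length B \<in> {3,4}"
    "\<And>d. d \<in> X \<Longrightarrow> \<exists>B\<in>set Bs. d \<in> Delta B" "(\<Sum>B\<leftarrow>Bs. weight B) \<le> card X"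
    using decomposableE[OF assms(1)] by blast
  obtain Cs where 2: "finite Y" "\<And>B. B \<in> set Cs \<Longrightarrow> distinct B \<and> length B \<in> {3,4}"
    "\<And>d. d \<in> Y \<Longrightarrow> \<exists>B\<in>set Cs. d \<in> Delta B" "(\<Sum>B\<leftarrow>Cs. weight B) \<le> card Y"
    using decomposableE[OF assms(2)] by blast
  define E where "E B C = (SOME Es. product_family B C Es)" for B :: "'a list" and C :: "'b list"
  have E: "product_family B C (E B C)" if "B \<in> set Bs" "C \<in> set Cs" for B C
    unfolding E_def using product_family_exists[of B C] 1(2)[OF that(1)] 2(2)[OF that(2)]
    by (simp add: someI_ex)
  note E = E[unfolded product_family_def]
  show ?thesis
  proof (rule decomposableI[where Bs = "concat (map (\<lambda>B. concat (map (E B) Cs)) Bs)"])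
    show "finite (X \<times> Y)" using 1 2 by simp
    show "distinct F \<and> length F \<in> {3,4}" if F: "F \<in> set (concat (map (\<lambda>B. concat (map (E B) Cs)) Bs))" for F
    proof -
      obtain B C where "B \<in> set Bs" "C \<in> set Cs" "F \<in> set (E B C)" using F by auto
      then show ?thesis using E by blast
    qed
    show "\<exists>F\<in>set (concat (map (\<lambda>B. concat (map (E B) Cs)) Bs)). d \<in> Delta F" if d0: "d \<in> X \<times> Y" for d
    proof -
      obtain x y where d: "d = (x, y)" "x \<in> X" "y \<in> Y" using d0 by auto
      then obtain B C where "B \<in> set Bs" "x \<in> Delta B" "C \<in> set Cs" "y \<in> Delta C" using 1(3) 2(3) by metis
      then obtain F where "F \<in> set (E B C)" "(x, y) \<in> Delta F" using E by blast
      with d \<open>B \<in> set Bs\<close> \<open>C \<in> set Cs\<close> show ?thesis by auto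
    qed
    have "(\<Sum>F\<leftarrow>concat (map (\<lambda>B. concat (map (E B) Cs)) Bs). weight F)
        = (\<Sum>B\<leftarrow>Bs. \<Sum>C\<leftarrow>Cs. \<Sum>F\<leftarrow>E B C. weight F)"
      by (simp add: sum_list_map_concat o_def)
    also have "\<dots> = (\<Sum>B\<leftarrow>Bs. \<Sum>C\<leftarrow>Cs. weight B * weight C)"
      using E by (intro arg_cong[where f = sum_list] map_cong refl) auto
    also have "\<dots> = (\<Sum>B\<leftarrow>Bs. weight B) * (\<Sum>C\<leftarrow>Cs. weight C)"
      by (simp add: sum_list_const_mult sum_list_mult_const)
    also have "\<dots> \<le> card X * card Y" using 1(4) 2(4) by (rule mult_le_mono)
    finally show "(\<Sum>F\<leftarrow>concat (map (\<lambda>B. concat (map (E B) Cs)) Bs). weight F) \<le> card (X \<times> Y)"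
      by (simp add: card_cartesian_product)
  qed
qed

section \<open>Triples and nested runs of integers\<close>

lemma Delta_triple: "Delta [0, a, a + b] \<supseteq> {a, b, a + b} - {0}" for a b :: "'a::ab_group_add"
  by (auto intro: DeltaI2[of a _ 0] DeltaI2[of "a + b" _ a] DeltaI2[of "a + b" _ 0])

text \<open>\<open>Delta\<close> is closed under negation, so only positive elements have to be
  covered. The two halves are disjoint, whence the factor 2.\<close>

lemma decomposable_symmetric:
  fixes A :: "int set"
  assumes "finite A" "A \<subseteq> {0<..}" "\<And>B. B \<in> set Bs \<Longrightarrow> distinct B \<and> length B \<in> K"
    "\<And>a. a \<in> A \<Longrightarrow> \<exists>B\<in>set Bs. a \<in> Delta B" "(\<Sum>B\<leftarrow>Bs. weight B) \<le> 2 * card A"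
  shows "decomposable K (A \<union> uminus ` A)"
proof (rule decomposableI[where Bs = Bs])
  show "\<exists>B\<in>set Bs. d \<in> Delta B" if "d \<in> A \<union> uminus ` A" for d
    using that assms(4) by (auto simp: Delta_uminus)
  have "A \<inter> uminus ` A = {}"
  proof (rule equals0I)
    fix x assume "x \<in> A \<inter> uminus ` A"
    then have "x \<in> {0<..}" "- x \<in> {0<..}" using assms(2) by auto
    then show False by simp
  qed
  then have "card (A \<union> uminus ` A) = 2 * card A"
    using assms(1) by (subst card_Un_disjoint) (auto simp: card_image)
  then show "(\<Sum>B\<leftarrow>Bs. weight B) \<le> card (A \<union> uminus ` A)" using assms(5) by simp
qed (use assms in auto)

lemma Delta_quadruple: "{a, b, c, b - a, c - a, c - b} - {0} \<subseteq> Delta [0, a, b, c]"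
  for a b c :: "'a::ab_group_add"
  by (auto intro: DeltaI2[of a _ 0] DeltaI2[of b _ 0] DeltaI2[of c _ 0]
      DeltaI2[of b _ a] DeltaI2[of c _ a] DeltaI2[of c _ b])

text \<open>A pair (a, b) stands for the block 0, a, a + b, whose positive differences are a, b and
  a + b when a and b are positive.\<close>

definition covers_sums :: "(int \<times> int) list \<Rightarrow> int \<Rightarrow> bool" where
  "covers_sums T x \<longleftrightarrow> (\<exists>(a, b)\<in>set T. x \<in> {a, b, a + b})"

text \<open>\<open>u - k\<close> and \<open>u + e + k\<close> are symmetric about u + e/2 at
  distance \<open>2 * k + e\<close>: the nested pairs of Skolem and Langford sequences. First
  entries run through one parity class; second entries and sums fill intervals.\<close>

definition nested :: "int \<Rightarrow> int \<Rightarrow> int \<Rightarrow> int \<Rightarrow> (int \<times> int) list" where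
  "nested e u i j = map (\<lambda>k. (2 * k + e, u - k)) [i..j]"

lemma covers_sums_Nil: "\<not> covers_sums [] x"
  by (simp add: covers_sums_def)

lemma covers_sums_Cons: "covers_sums ((a, b) # T) x \<longleftrightarrow> x = a \<or> x = b \<or> x = a + b \<or> covers_sums T x"
  by (auto simp: covers_sums_def)

lemma covers_sums_append: "covers_sums (T @ U) x \<longleftrightarrow> covers_sums T x \<or> covers_sums U x"
  by (auto simp: covers_sums_def)

text \<open>Turns coverage by a run with symbolic ends into linear inequalities and one parity
  condition.\<close>

lemma covers_sums_nested:
  "covers_sums (nested e u i j) x \<longleftrightarrow> even (x - e) \<and> 2 * i + e \<le> x \<and> x \<le> 2 * j + e \<or>
     u - j \<le> x \<and> x \<le> u - i \<or> u + e + i \<le> x \<and> x \<le> u + e + j"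
proof -
  have "covers_sums (nested e u i j) x \<longleftrightarrow> (\<exists>k. i \<le> k \<and> k \<le> j \<and> (x = 2 * k + e \<or> x = u - k \<or> x = u + e + k))"
    by (auto simp: covers_sums_def nested_def algebra_simps)
  also have "\<dots> \<longleftrightarrow> (\<exists>k. i \<le> k \<and> k \<le> j \<and> x = 2 * k + e) \<or> (\<exists>k. i \<le> k \<and> k \<le> j \<and> x = u - k) \<or>
      (\<exists>k. i \<le> k \<and> k \<le> j \<and> x = u + e + k)" by blast
  also have "(\<exists>k. i \<le> k \<and> k \<le> j \<and> x = 2 * k + e) \<longleftrightarrow> even (x - e) \<and> 2 * i + e \<le> x \<and> x \<le> 2 * j + e"
    by presburger
  also have "(\<exists>k. i \<le> k \<and> k \<le> j \<and> x = u - k) \<longleftrightarrow> u - j \<le> x \<and> x \<le> u - i"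
    by presburger
  also have "(\<exists>k. i \<le> k \<and> k \<le> j \<and> x = u + e + k) \<longleftrightarrow> u + e + i \<le> x \<and> x \<le> u + e + j"
    by presburger
  finally show ?thesis by blast
qed

lemma length_nested: "length (nested e u i j) = nat (j - i + 1)"
  by (simp add: nested_def)

lemmas covers_sums_simps = covers_sums_Nil covers_sums_Cons covers_sums_append covers_sums_nested

definition positive_pairs :: "(int \<times> int) list \<Rightarrow> bool" where
  "positive_pairs T \<longleftrightarrow> (\<forall>(a, b)\<in>set T. 0 < a \<and> 0 < b)"

text \<open>Along a run the first entry increases and the second decreases, so one end of the run
  decides each sign.\<close>

lemma positive_pairs_simps:
  "positive_pairs []"
  "positive_pairs ((a, b) # T) \<longleftrightarrow> 0 < a \<and> 0 < b \<and> positive_pairs T"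
  "positive_pairs (T @ U) \<longleftrightarrow> positive_pairs T \<and> positive_pairs U"
  "positive_pairs (nested e u i j) \<longleftrightarrow> j < i \<or> 0 < 2 * i + e \<and> 0 < u - j"
  by (auto simp: positive_pairs_def nested_def) 

text \<open>Positivity makes 0, a, a + b distinct, and such a block has weight 6. \<open>Qs\<close>
  holds the exceptional blocks, later at most a single one of size 4.\<close>

lemma decomposable_triples:
  fixes A :: "int set"
  assumes "finite A" "A \<subseteq> {0<..}" "3 \<in> K" "\<And>B. B \<in> set Qs \<Longrightarrow> distinct B \<and> length B \<in> K"
    "positive_pairs T" "\<And>x. x \<in> A \<Longrightarrow> (\<exists>B\<in>set Qs. x \<in> Delta B) \<or> covers_sums T x"
    "6 * length T + (\<Sum>B\<leftarrow>Qs. weight B) \<le> 2 * card A"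
  shows "decomposable K (A \<union> uminus ` A)"
proof (rule decomposable_symmetric[where Bs = "Qs @ map (\<lambda>(a, b). [0, a, a + b]) T"])
  show "distinct B \<and> length B \<in> K" if B: "B \<in> set (Qs @ map (\<lambda>(a, b). [0, a, a + b]) T)" for B
  proof (cases "B \<in> set Qs")
    case False
    then obtain a b where ab: "(a, b) \<in> set T" "B = [0, a, a + b]" using B by auto
    then have "0 < a" "0 < b" using assms(5) by (auto simp: positive_pairs_def)
    then show ?thesis using ab assms(3) by (simp add: numeral_3_eq_3)
  qed (use assms(4) in blast)
  show "\<exists>B\<in>set (Qs @ map (\<lambda>(a, b). [0, a, a + b]) T). x \<in> Delta B" if "x \<in> A" for x
    using assms(6)[OF that]
  proof
    assume "covers_sums T x"
    then obtain a b where "(a, b) \<in> set T" "x \<in> {a, b, a + b}" by (auto simp: covers_sums_def)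
    moreover have "x \<noteq> 0" using \<open>x \<in> A\<close> assms(2) by auto
    ultimately show ?thesis using Delta_triple[of a b] by force
  qed auto
  have "map weight (map (\<lambda>(a, b). [0, a, a + b]) T) = map (\<lambda>_. 6) T"
    by (auto simp: weight_def)
  then have "(\<Sum>B\<leftarrow>map (\<lambda>(a, b). [0, a, a + b]) T. weight B) = 6 * length T"
    by (simp only: sum_list_triv) simp
  then show "(\<Sum>B\<leftarrow>Qs @ map (\<lambda>(a, b). [0, a, a + b]) T. weight B) \<le> 2 * card A" using assms(7) by simp
qed (use assms in auto)

section \<open>Whole rows over a set of heights\<close>

text \<open>The map \<open>\<phi>\<close> below permutes \<open>{-r..r}\<close>, and so does \<open>x \<mapsto> x + \<phi> x\<close>.\<close>

lemma decomposable_rows: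
  assumes "decomposable {3} H" "0 \<le> (r::int)"
  shows "decomposable {3} ({-r..r} \<times> H)"
proof -
  obtain Bs where 1: "finite H" "\<And>B. B \<in> set Bs \<Longrightarrow> distinct B \<and> length B \<in> {3}"
    "\<And>d. d \<in> H \<Longrightarrow> \<exists>B\<in>set Bs. d \<in> Delta B" "(\<Sum>B\<leftarrow>Bs. weight B) \<le> card H"
    using decomposableE[OF assms(1)] by blast
  \<comment> \<open>\<phi> sends {-r..0} onto {0..r} and {1..r} onto {-r..-1}. The sums are 2x + r
    and 2x - r - 1, one run for each parity.\<close>
  define \<phi> where "\<phi> x = (if x \<le> 0 then x + r else x - r - 1)" for x
  \<comment> \<open>The three differences of \<open>B\<close> receive first coordinates x, \<phi> x
    and x + \<phi> x, each of which takes every value in {-r..r}.\<close>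
  define E where "E B x = [(0, B ! 0), (x, B ! 1), (x + \<phi> x, B ! 2)]" for B :: "'a list" and x
  have sur1: "\<exists>x\<in>{-r..r}. \<phi> x = y" if "y \<in> {-r..r}" for y
    using that by (intro bexI[of _ "if y \<ge> 0 then y - r else y + r + 1"]) (auto simp: \<phi>_def)
  have sur2: "\<exists>x\<in>{-r..r}. x + \<phi> x = y" if "y \<in> {-r..r}" for y
  proof (cases "even (y + r)")
    case True
    then show ?thesis using that by (intro bexI[of _ "(y - r) div 2"]) (auto simp: \<phi>_def elim!: evenE)
  next
    case False
    then show ?thesis using that by (intro bexI[of _ "(y + r + 1) div 2"]) (auto simp: \<phi>_def elim!: oddE)
  qed
  show ?thesis
  proof (rule decomposableI[where Bs = "concat (map (\<lambda>B. map (E B) [-r..r]) Bs)"])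
    show "finite ({-r..r} \<times> H)" using 1 by simp
    show "distinct F \<and> length F \<in> {3}" if F: "F \<in> set (concat (map (\<lambda>B. map (E B) [-r..r]) Bs))" for F
    proof -
      obtain B x where B: "B \<in> set Bs" "F = E B x" using F by auto
      then have "distinct B" "length B = 3" using 1(2) by auto
      then show ?thesis using B(2) by (simp add: E_def nth_eq_iff_index_eq)
    qed
    show "\<exists>F\<in>set (concat (map (\<lambda>B. map (E B) [-r..r]) Bs)). d \<in> Delta F" if d0: "d \<in> {-r..r} \<times> H" for d
    proof -
      obtain y h where d: "d = (y, h)" "y \<in> {-r..r}" "h \<in> H" using d0 by auto
      obtain B where B: "B \<in> set Bs" "h \<in> Delta B" using 1(3) d by blast
      then have len: "length B = 3" "distinct B" using 1(2) by auto
      obtain i j where ij: "i < 3" "j < 3" "i \<noteq> j" "h = B ! i - B ! j"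
        using B(2) len by (auto elim!: DeltaE)
      \<comment> \<open>Later entry minus earlier entry; the opposite order follows by
        negation.\<close>
      have pos: "\<exists>x\<in>{-r..r}. (z, B ! j - B ! i) \<in> Delta (E B x)"
        if ij: "i < j" "j < 3" and z: "z \<in> {-r..r}" for i j z
      proof -
        have ne: "B ! i \<noteq> B ! j" using ij len by (auto simp: nth_eq_iff_index_eq)
        from ij consider "i = 0" "j = 1" | "i = 1" "j = 2" | "i = 0" "j = 2" by linarith
        then show ?thesis
        proof cases
          case 1
          then show ?thesis using z ne
            by (intro bexI[of _ z] DeltaI2[of "(z, B ! 1)" _ "(0, B ! 0)"]) (auto simp: E_def)
        next
          case 2
          obtain x where "x \<in> {-r..r}" "\<phi> x = z" using sur1 z by blast
          then show ?thesis using 2 ne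
            by (intro bexI[of _ x] DeltaI2[of "(x + \<phi> x, B ! 2)" _ "(x, B ! 1)"]) (auto simp: E_def)
        next
          case 3
          obtain x where "x \<in> {-r..r}" "x + \<phi> x = z" using sur2 z by blast
          then show ?thesis using 3 ne
            by (intro bexI[of _ x] DeltaI2[of "(x + \<phi> x, B ! 2)" _ "(0, B ! 0)"]) (auto simp: E_def)
        qed
      qed
      have "\<exists>x\<in>{-r..r}. d \<in> Delta (E B x)"
      proof (cases "i < j")
        case True
        have "\<exists>x\<in>{-r..r}. - d \<in> Delta (E B x)"
          using pos[OF True ij(2), of "- y"] ij d by auto
        then show ?thesis by (simp add: Delta_uminus)
      next
        case False
        then show ?thesis using pos[of j i y] ij d by auto
      qed
      then show ?thesis using B(1) by auto
    qed
    have "(\<Sum>F\<leftarrow>concat (map (\<lambda>B. map (E B) [-r..r]) Bs). weight F) = (\<Sum>B\<leftarrow>Bs. 6 * card {-r..r})"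
      using assms(2) by (simp add: sum_list_map_concat o_def E_def weight_def sum_list_triv)
    also have "\<dots> = (\<Sum>B\<leftarrow>Bs. weight B) * card {-r..r}"
      using 1(2) by (subst sum_list_mult_const[symmetric], intro arg_cong[where f = sum_list] map_cong)
        (auto simp: weight_def)
    also have "\<dots> \<le> card ({-r..r} \<times> H)"
      using 1(4) by (simp add: card_cartesian_product mult.commute)
    finally show "(\<Sum>F\<leftarrow>concat (map (\<lambda>B. map (E B) [-r..r]) Bs). weight F) \<le> card ({-r..r} \<times> H)" .
  qed
qed

section \<open>Splitting intervals into triples and at most one block of size four\<close>

text \<open>The multiples \<open>t, .., t * L\<close> are left out because they inherit a decomposition from \<open>{-L..L}\<close>.\<close>

definition scaling_step :: "int \<Rightarrow> int \<Rightarrow> int \<Rightarrow> bool" where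
  "scaling_step t L M \<longleftrightarrow> 0 < t \<and> 0 \<le> L \<and> t * L \<le> M \<and>
     decomposable {3} (({1..M} - (*) t ` {1..L}) \<union> uminus ` ({1..M} - (*) t ` {1..L}))"

text \<open>The omitted multiples are \<open>L\<close> distinct numbers in \<open>{1..M}\<close>, so
  \<open>M - L\<close> numbers remain, three for each triple.\<close>

lemma scaling_stepI:
  assumes "0 < t" "0 \<le> L" "t * L \<le> M" "positive_pairs T"
    "\<And>x. 1 \<le> x \<Longrightarrow> x \<le> M \<Longrightarrow> x \<notin> (*) t ` {1..L} \<Longrightarrow> covers_sums T x"
    "3 * int (length T) \<le> M - L"
  shows "scaling_step t L M"
proof -
  have "(*) t ` {1..L} \<subseteq> {1..M}"
  proof safe
    fix x assume "x \<in> {1..L}"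
    then have "0 < t * x" "t * x \<le> t * L" using assms(1) by (auto intro!: mult_pos_pos)
    then show "t * x \<in> {1..M}" using assms(3) by auto
  qed
  then have "card ({1..M} - (*) t ` {1..L}) = card {1..M} - card ((*) t ` {1..L})"
    by (intro card_Diff_subset) auto
  moreover have "card ((*) t ` {1..L}) = card {1..L}"
    using assms(1) by (intro card_image inj_onI) auto
  ultimately have "card ({1..M} - (*) t ` {1..L}) = nat (M - L)"
    using assms(2) by simp
  then have "decomposable {3} (({1..M} - (*) t ` {1..L}) \<union> uminus ` ({1..M} - (*) t ` {1..L}))"
    using assms by (intro decomposable_triples[where Qs = "[]" and T = T]) auto
  then show ?thesis using assms by (simp add: scaling_step_def)
qed

text \<open>The triples are 2k + 1, 3L - k, 3L + 1 + k for 0 \<le> k < L: the odd numbers below 2L,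
  then 2L + 1..3L and 3L + 1..4L.\<close>

lemma scaling_step_quadruple:
  assumes "0 \<le> L"
  shows "scaling_step 2 L (4 * L)"
proof (rule scaling_stepI[where T = "nested 1 (3 * L) 0 (L - 1)"])
  fix x :: int assume x: "1 \<le> x" "x \<le> 4 * L" "x \<notin> (*) 2 ` {1..L}"
  have "odd x \<or> 2 * L < x" 
  proof (rule ccontr)
    assume "\<not> (odd x \<or> 2 * L < x)"
    then obtain y where "x = 2 * y" "y \<le> L" by (auto elim!: evenE)
    then show False using x by auto
  qed
  then show "covers_sums (nested 1 (3 * L) 0 (L - 1)) x" using x(1,2) unfolding covers_sums_nested by presburger
qed (use assms in \<open>auto simp: positive_pairs_simps length_nested\<close>)

text \<open>The triples are 2k + 1, 3L + 2 - k, 3L + 3 + k for 0 \<le> k \<le> L: the odd numbers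
  now reach 2L + 1, and the upper part is 2L + 2..4L + 3.\<close>

lemma scaling_step_quadruple_plus_3:
  assumes "0 \<le> L"
  shows "scaling_step 2 L (4 * L + 3)"
proof (rule scaling_stepI[where T = "nested 1 (3 * L + 2) 0 L"])
  fix x :: int assume x: "1 \<le> x" "x \<le> 4 * L + 3" "x \<notin> (*) 2 ` {1..L}"
  have "odd x \<or> 2 * L < x" 
  proof (rule ccontr)
    assume "\<not> (odd x \<or> 2 * L < x)"
    then obtain y where "x = 2 * y" "y \<le> L" by (auto elim!: evenE)
    then show False using x by auto
  qed
  then show "covers_sums (nested 1 (3 * L + 2) 0 L) x" using x(1,2) unfolding covers_sums_nested by presburger
qed (use assms in \<open>auto simp: positive_pairs_simps length_nested\<close>)

lemma scaling_stepI_1_2: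
  assumes "2 \<le> M" "positive_pairs T" "\<And>x. 3 \<le> x \<Longrightarrow> x \<le> M \<Longrightarrow> covers_sums T x" "3 * int (length T) \<le> M - 2"
  shows "scaling_step 1 2 M"
  using assms by (intro scaling_stepI[where T = T]) auto

text \<open>The parity conditions have the form in which \<open>covers_sums_nested\<close> produces
  them for e = 0 and e = 1; the witness makes them linear.\<close>

lemma parity_cases: "\<exists>y. x = 2 * y \<and> even (x - 0) \<or> x = 2 * y + 1 \<and> even (x - 1)" for x :: int
proof (cases "even x")
  case True
  then show ?thesis by (intro exI[of _ "x div 2"]) simp
next
  case False
  then show ?thesis by (intro exI[of _ "x div 2"]) simp
qed

text \<open>The lists of triples below are of Skolem type: three nested runs and a few exceptional
  triples, found by a computer search over the ends of the runs.\<close>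

lemma scaling_step_12_2:
  assumes "4 \<le> s"
  shows "scaling_step 1 2 (12 * s + 2)"
proof -
  \<comment> \<open>The first entries of the runs are the even numbers 4..4s and the odd numbers 2s
    + 5..4s - 5 and 3..2s + 1; the five single pairs fill the gaps. At s = 4 the second run is
    empty.\<close>
  define T where "T = [(4 * s + 1, 6 * s), (4 * s - 3, 4 * s + 2), (5 * s - 1, 7 * s + 2), (2 * s + 3, 10 * s - 1), (4 * s - 1, 6 * s + 1)] @
    nested 0 (10 * s) 2 (2 * s) @
    nested 1 (6 * s) (s + 2) (2 * s - 3) @ nested 1 (6 * s) 1 (s)"
  show ?thesis
  proof (rule scaling_stepI_1_2[where T = T])
    fix x assume x: "3 \<le> x" "x \<le> 12 * s + 2"
    show "covers_sums T x"
      using parity_cases[of x] x assms unfolding T_def covers_sums_simps by (smt (z3))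
  qed (use assms in \<open>auto simp: T_def positive_pairs_simps length_nested\<close>)
qed

lemma scaling_step_12_5:
  assumes "3 \<le> s"
  shows "scaling_step 1 2 (12 * s + 5)"
proof -
  \<comment> \<open>The first entries of the runs are the even numbers 4..4s - 4 and the odd numbers
    2s + 3..4s + 1 and 7..2s - 1; 3 and 5 go into single pairs. At s = 3 the third run is
    empty.\<close>
  define T where "T = [(5, 6 * s), (3, 12 * s + 1), (2 * s + 1, 10 * s + 1), (6 * s + 1, 6 * s + 2), (4 * s, 6 * s + 3), (4 * s - 2, 6 * s + 4), (5 * s + 2, 7 * s + 3)] @
    nested 0 (10 * s + 2) 2 (2 * s - 2) @
    nested 1 (6 * s + 2) (s + 1) (2 * s) @ nested 1 (6 * s + 2) 3 (s - 1)"
  show ?thesis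
  proof (rule scaling_stepI_1_2[where T = T])
    fix x assume x: "3 \<le> x" "x \<le> 12 * s + 5"
    show "covers_sums T x"
      using parity_cases[of x] x assms unfolding T_def covers_sums_simps by (smt (z3))
  qed (use assms in \<open>auto simp: T_def positive_pairs_simps length_nested\<close>)
qed

text \<open>Triples cannot split 3..14: the four sums would total half of 102, while 11 + 12 + 13 +
  14 = 50. Hence the stretching by 3, which leaves out 3 and 6 instead of 1 and 2.\<close>

lemma scaling_step_14: "scaling_step 3 2 14"
proof (rule scaling_stepI[where T = "[(4, 10), (2, 11), (5, 7), (1, 8)]"])
  fix x :: int assume "1 \<le> x" "x \<le> 14" "x \<notin> (*) 3 ` {1..2}"
  moreover have "3 * 1 \<in> (*) 3 ` {1..2::int}" "3 * 2 \<in> (*) 3 ` {1..2::int}" by (intro imageI; simp)+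
  ultimately have "x \<noteq> 3" "x \<noteq> 6" "1 \<le> x" "x \<le> 14" by auto
  then show "covers_sums [(4, 10), (2, 11), (5, 7), (1, 8)] x"
      unfolding covers_sums_simps by (smt (z3))
qed (auto simp: positive_pairs_simps)

text \<open>17 and 29 are of the form 12s + 5, and 26 and 38 of the form 12s + 2, with
  \<open>s\<close> below the range of the general runs.\<close>

lemma scaling_step_17: "scaling_step 1 2 17"
proof (rule scaling_stepI[where T = "[(5, 11), (3, 12), (4, 10), (8, 9), (6, 7)]"])
  fix x :: int assume "1 \<le> x" "x \<le> 17" "x \<notin> (*) 1 ` {1..2}"
  moreover have "1 * 1 \<in> (*) 1 ` {1..2::int}" "1 * 2 \<in> (*) 1 ` {1..2::int}" by (intro imageI; simp)+
  ultimately have "x \<noteq> 1" "x \<noteq> 2" "1 \<le> x" "x \<le> 17" by auto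
  then show "covers_sums [(5, 11), (3, 12), (4, 10), (8, 9), (6, 7)] x"
      unfolding covers_sums_simps by (smt (z3))
qed (auto simp: positive_pairs_simps)

lemma scaling_step_26: "scaling_step 1 2 26"
proof (rule scaling_stepI[where T = "[(4, 20), (7, 19), (10, 15), (5, 18), (9, 12), (3, 13), (8, 14), (6, 11)]"])
  fix x :: int assume "1 \<le> x" "x \<le> 26" "x \<notin> (*) 1 ` {1..2}"
  moreover have "1 * 1 \<in> (*) 1 ` {1..2::int}" "1 * 2 \<in> (*) 1 ` {1..2::int}" by (intro imageI; simp)+
  ultimately have "x \<noteq> 1" "x \<noteq> 2" "1 \<le> x" "x \<le> 26" by auto
  then show "covers_sums [(4, 20), (7, 19), (10, 15), (5, 18), (9, 12), (3, 13), (8, 14), (6, 11)] x"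
      unfolding covers_sums_simps by (smt (z3))
qed (auto simp: positive_pairs_simps)

lemma scaling_step_29: "scaling_step 1 2 29"
proof (rule scaling_stepI[where T = "[(10, 18), (7, 20), (9, 15), (4, 22), (6, 23), (8, 13), (11, 14), (3, 16), (5, 12)]"])
  fix x :: int assume "1 \<le> x" "x \<le> 29" "x \<notin> (*) 1 ` {1..2}"
  moreover have "1 * 1 \<in> (*) 1 ` {1..2::int}" "1 * 2 \<in> (*) 1 ` {1..2::int}" by (intro imageI; simp)+
  ultimately have "x \<noteq> 1" "x \<noteq> 2" "1 \<le> x" "x \<le> 29" by auto
  then show "covers_sums [(10, 18), (7, 20), (9, 15), (4, 22), (6, 23), (8, 13), (11, 14), (3, 16), (5, 12)] x"
      unfolding covers_sums_simps by (smt (z3))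
qed (auto simp: positive_pairs_simps)

lemma scaling_step_38: "scaling_step 1 2 38"
proof (rule scaling_stepI[where T = "[(17, 19), (9, 28), (12, 21), (5, 27), (11, 24), (3, 31), (7, 18), (15, 23), (13, 16), (10, 20), (4, 22), (6, 8)]"])
  fix x :: int assume "1 \<le> x" "x \<le> 38" "x \<notin> (*) 1 ` {1..2}"
  moreover have "1 * 1 \<in> (*) 1 ` {1..2::int}" "1 * 2 \<in> (*) 1 ` {1..2::int}" by (intro imageI; simp)+
  ultimately have "x \<noteq> 1" "x \<noteq> 2" "1 \<le> x" "x \<le> 38" by auto
  then show "covers_sums [(17, 19), (9, 28), (12, 21), (5, 27), (11, 24), (3, 31), (7, 18), (15, 23), (13, 16), (10, 20), (4, 22), (6, 8)] x"
      unfolding covers_sums_simps by (smt (z3))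
qed (auto simp: positive_pairs_simps)

text \<open>Triples alone are impossible: a, b, a + b have an even sum, while 1 + .. + (12s + 6) is
  odd. The same holds for 12s + 9.\<close>

lemma decomposable_interval_12_6:
  assumes "2 \<le> (s::int)"
  shows "decomposable {3, 4} ({1..12 * s + 6} \<union> uminus ` {1..12 * s + 6})"
proof -
  \<comment> \<open>The block of size 4 takes 2, 4, 6, 10s + 3, 10s + 7 and 10s + 9, so the even run
    starts at 8.\<close>
  define T where "T = [(4 * s + 3, 6 * s + 5), (1, 10 * s + 4), (4 * s + 2, 6 * s + 4)] @
    nested 0 (10 * s + 6) 4 (2 * s) @
    nested 1 (6 * s + 4) (s - 1) (2 * s) @ nested 1 (6 * s + 4) 1 (s - 2)"
  show ?thesis
  proof (rule decomposable_triples[where T = T and Qs = "[[0, 2, 6, 10 * s + 9]]"])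
    fix x assume x: "x \<in> {1..12 * s + 6}"
    show "(\<exists>B\<in>set [[0, 2, 6, 10 * s + 9]]. x \<in> Delta B) \<or> covers_sums T x"
    proof (cases "x \<in> Delta [0, 2, 6, 10 * s + 9]")
      case False
      moreover have "x \<noteq> 0" using x by simp
      ultimately have "x \<notin> {2, 6, 10 * s + 9, 6 - 2, 10 * s + 9 - 2, 10 * s + 9 - 6}"
        using subsetD[OF Delta_quadruple[of 2 6 "10 * s + 9"], of x] by blast
      moreover obtain y where "x = 2 * y \<and> even (x - 0) \<or> x = 2 * y + 1 \<and> even (x - 1)"
        using parity_cases by blast
      ultimately have "covers_sums T x" using x assms unfolding T_def covers_sums_simps insert_iff empty_iff atLeastAtMost_iff by (smt (z3))
      then show ?thesis ..
    qed simp
  qed (use assms in \<open>auto simp: T_def positive_pairs_simps length_nested weight_def\<close>)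
qed

lemma decomposable_interval_12_9:
  assumes "2 \<le> (s::int)"
  shows "decomposable {3, 4} ({1..12 * s + 9} \<union> uminus ` {1..12 * s + 9})"
proof -
  \<comment> \<open>The block of size 4 takes 3, 6s + 2, 6s + 4, 6s + 5, 12s + 6 and 12s + 9. The
    last run, empty for s = 2, starts at 5.\<close>
  define T where "T = [(1, 12 * s + 7), (4 * s + 2, 6 * s + 3), (4 * s, 8 * s + 5)] @
    nested 0 (10 * s + 5) 1 (2 * s - 1) @
    nested 1 (6 * s + 3) (s) (2 * s) @ nested 1 (6 * s + 3) 2 (s - 1)"
  show ?thesis
  proof (rule decomposable_triples[where T = T and Qs = "[[0, 3, 6 * s + 5, 12 * s + 9]]"])
    fix x assume x: "x \<in> {1..12 * s + 9}"
    show "(\<exists>B\<in>set [[0, 3, 6 * s + 5, 12 * s + 9]]. x \<in> Delta B) \<or> covers_sums T x"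
    proof (cases "x \<in> Delta [0, 3, 6 * s + 5, 12 * s + 9]")
      case False
      moreover have "x \<noteq> 0" using x by simp
      ultimately have "x \<notin> {3, 6 * s + 5, 12 * s + 9, 6 * s + 5 - 3, 12 * s + 9 - 3, 12 * s + 9 - (6 * s + 5)}"
        using subsetD[OF Delta_quadruple[of 3 "6 * s + 5" "12 * s + 9"], of x] by blast
      moreover obtain y where "x = 2 * y \<and> even (x - 0) \<or> x = 2 * y + 1 \<and> even (x - 1)"
        using parity_cases by blast
      ultimately have "covers_sums T x" using x assms unfolding T_def covers_sums_simps insert_iff empty_iff atLeastAtMost_iff by (smt (z3))
      then show ?thesis ..
    qed simp
  qed (use assms in \<open>auto simp: T_def positive_pairs_simps length_nested weight_def\<close>)
qed

text \<open>0, 1, 4, 6 is the perfect Golomb ruler with four marks.\<close>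

lemma decomposable_interval_6: "decomposable {3, 4} ({1..6} \<union> uminus ` {1..6::int})"
proof (rule decomposable_triples[where T = "[]" and Qs = "[[0, 1, 4, 6]]"])
  fix x :: int assume x: "x \<in> {1..6}"
  show "(\<exists>B\<in>set [[0, 1, 4, 6]]. x \<in> Delta B) \<or> covers_sums [] x"
  proof (cases "x \<in> Delta [0, 1, 4, 6]")
    case False
    moreover have "x \<noteq> 0" using x by simp
    ultimately have "x \<notin> {1, 4, 6, 4 - 1, 6 - 1, 6 - 4}"
      using subsetD[OF Delta_quadruple[of 1 4 "6 :: int"], of x] by blast
    then have "covers_sums [] x" using x unfolding covers_sums_simps insert_iff empty_iff atLeastAtMost_iff by (smt (z3))
    then show ?thesis ..
  qed simp
qed (auto simp: positive_pairs_simps weight_def)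

lemma decomposable_interval_9: "decomposable {3, 4} ({1..9} \<union> uminus ` {1..9::int})"
proof (rule decomposable_triples[where T = "[(1, 7)]" and Qs = "[[0, 3, 5, 9]]"])
  fix x :: int assume x: "x \<in> {1..9}"
  show "(\<exists>B\<in>set [[0, 3, 5, 9]]. x \<in> Delta B) \<or> covers_sums [(1, 7)] x"
  proof (cases "x \<in> Delta [0, 3, 5, 9]")
    case False
    moreover have "x \<noteq> 0" using x by simp
    ultimately have "x \<notin> {3, 5, 9, 5 - 3, 9 - 3, 9 - 5}"
      using subsetD[OF Delta_quadruple[of 3 5 "9 :: int"], of x] by blast
    then have "covers_sums [(1, 7)] x" using x unfolding covers_sums_simps insert_iff empty_iff atLeastAtMost_iff by (smt (z3))
    then show ?thesis ..
  qed simp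
qed (auto simp: positive_pairs_simps weight_def)

lemma decomposable_interval_18: "decomposable {3, 4} ({1..18} \<union> uminus ` {1..18::int})"
proof (rule decomposable_triples[where T = "[(8, 10), (4, 13), (7, 9), (5, 6)]" and Qs = "[[0, 1, 3, 15]]"])
  fix x :: int assume x: "x \<in> {1..18}"
  show "(\<exists>B\<in>set [[0, 1, 3, 15]]. x \<in> Delta B) \<or> covers_sums [(8, 10), (4, 13), (7, 9), (5, 6)] x"
  proof (cases "x \<in> Delta [0, 1, 3, 15]")
    case False
    moreover have "x \<noteq> 0" using x by simp
    ultimately have "x \<notin> {1, 3, 15, 3 - 1, 15 - 1, 15 - 3}"
      using subsetD[OF Delta_quadruple[of 1 3 "15 :: int"], of x] by blast
    then have "covers_sums [(8, 10), (4, 13), (7, 9), (5, 6)] x" using x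
      unfolding covers_sums_simps insert_iff empty_iff atLeastAtMost_iff by (smt (z3))
    then show ?thesis ..
  qed simp
qed (auto simp: positive_pairs_simps weight_def)

lemma decomposable_interval_21: "decomposable {3, 4} ({1..21} \<union> uminus ` {1..21::int})"
proof (rule decomposable_triples[where T = "[(7, 11), (4, 15), (5, 16), (6, 14), (8, 9)]" and Qs = "[[0, 1, 3, 13]]"])
  fix x :: int assume x: "x \<in> {1..21}"
  show "(\<exists>B\<in>set [[0, 1, 3, 13]]. x \<in> Delta B) \<or> covers_sums [(7, 11), (4, 15), (5, 16), (6, 14), (8, 9)] x"
  proof (cases "x \<in> Delta [0, 1, 3, 13]")
    case False
    moreover have "x \<noteq> 0" using x by simp
    ultimately have "x \<notin> {1, 3, 13, 3 - 1, 13 - 1, 13 - 3}"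
      using subsetD[OF Delta_quadruple[of 1 3 "13 :: int"], of x] by blast
    then have "covers_sums [(7, 11), (4, 15), (5, 16), (6, 14), (8, 9)] x" using x
      unfolding covers_sums_simps insert_iff empty_iff atLeastAtMost_iff by (smt (z3))
    then show ?thesis ..
  qed simp
qed (auto simp: positive_pairs_simps weight_def)

section \<open>Stretching intervals and boxes\<close>

lemma scaling_step_disjoint:
  assumes "0 < (t::int)"
  shows "(*) t ` {-L..L} \<inter> (({1..M} - (*) t ` {1..L}) \<union> uminus ` ({1..M} - (*) t ` {1..L})) = {}"
proof -
  \<comment> \<open>A positive value forces \<open>z \<in> {1..L}\<close>, and these multiples were
    removed.\<close>
  have *: "t * z \<notin> {1..M} - (*) t ` {1..L}" if "z \<in> {-L..L}" for z
  proof
    assume z: "t * z \<in> {1..M} - (*) t ` {1..L}"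
    then have "0 < t * z" by simp
    then have "0 < z" using assms by (simp add: zero_less_mult_iff)
    then show False using z that by auto
  qed
  have "t * z \<noteq> - a" if "z \<in> {-L..L}" "a \<in> {1..M} - (*) t ` {1..L}" for z a
  proof
    assume "t * z = - a"
    then have "a = t * (- z)" by simp
    then show False using *[of "- z"] that by simp
  qed
  with * show ?thesis by blast
qed

lemma scaling_step_union:
  assumes "0 < (t::int)" "0 \<le> L" "t * L \<le> M"
  shows "(*) t ` {-L..L} \<union> (({1..M} - (*) t ` {1..L}) \<union> uminus ` ({1..M} - (*) t ` {1..L})) = {-M..M}"
    (is "?I \<union> (?A \<union> uminus ` ?A) = _")
proof (intro equalityI subsetI)
  fix x assume "x \<in> {-M..M}"
  have *: "y \<in> ?I \<or> y \<in> ?A" if "0 < y" "y \<le> M" for y using that by auto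
  consider "x = 0" | "0 < x" | "0 < - x" by linarith
  then show "x \<in> ?I \<union> (?A \<union> uminus ` ?A)"
  proof cases
    case 1
    then show ?thesis using assms(2) by (auto intro!: image_eqI[of _ _ 0])
  next
    case 2
    then show ?thesis using *[of x] \<open>x \<in> _\<close> by auto
  next
    case 3
    then have "- x \<in> ?I \<or> - x \<in> ?A" using *[of "- x"] \<open>x \<in> _\<close> by auto
    then show ?thesis
    proof
      assume "- x \<in> ?I"
      then obtain z where "z \<in> {-L..L}" "x = t * (- z)" by (auto simp: algebra_simps)
      then have "x \<in> ?I" by (intro image_eqI[of _ _ "- z"]) auto
      then show ?thesis by blast
    next
      assume "- x \<in> ?A"
      then have "- (- x) \<in> uminus ` ?A" by (rule imageI)
      then show ?thesis by simp
    qed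
  qed
next
  fix x assume "x \<in> ?I \<union> (?A \<union> uminus ` ?A)"
  moreover have "x \<in> {-M..M}" if x: "x \<in> ?I"
  proof -
    obtain z where z: "z \<in> {-L..L}" "x = t * z" using x by blast
    then have "t * z \<le> t * L" "t * (- L) \<le> t * z" using assms(1) by (simp_all only: mult_le_cancel_left_pos) auto
    then show ?thesis using z assms(3) by simp
  qed
  ultimately show "x \<in> {-M..M}" by auto
qed

text \<open>The arguments are half-widths: an n x m code belongs to r = n - 1 and M = m - 1.\<close>

definition punctured_box :: "int \<Rightarrow> int \<Rightarrow> (int \<times> int) set" where
  "punctured_box r M = {-r..r} \<times> {-M..M} - {(0, 0)}"

lemma finite_punctured_box: "finite (punctured_box r M)"
  by (simp add: punctured_box_def)

lemma card_punctured_box: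
  assumes "0 \<le> r" "0 \<le> M"
  shows "int (card (punctured_box r M)) = (2 * r + 1) * (2 * M + 1) - 1"
proof -
  have "card (punctured_box r M) = card ({-r..r} \<times> {-M..M}) - 1"
    using assms unfolding punctured_box_def by (subst card_Diff_singleton) auto
  also have "\<dots> = nat (2 * r + 1) * nat (2 * M + 1) - 1" by (simp add: card_cartesian_product)
  finally have "card (punctured_box r M) + 1 = nat (2 * r + 1) * nat (2 * M + 1)" using assms by simp
  then have "int (card (punctured_box r M)) + 1 = int (nat (2 * r + 1) * nat (2 * M + 1))" by presburger
  then show ?thesis using assms by simp
qed

lemma decomposable_punctured_box_swap:
  assumes "decomposable K (punctured_box r M)"
  shows "decomposable K (punctured_box M r)"
proof -
  have "decomposable K (prod.swap ` punctured_box r M)"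
    using assms by (rule decomposable_image) auto
  also have "prod.swap ` punctured_box r M = punctured_box M r" by (force simp: punctured_box_def)
  finally show ?thesis .
qed

lemma decomposable_interval_step:
  assumes "scaling_step t L M" "3 \<in> K" "decomposable K ({-L..L} - {0})"
  shows "decomposable K ({-M..M} - {0})"
proof -
  define H where "H = ({1..M} - (*) t ` {1..L}) \<union> uminus ` ({1..M} - (*) t ` {1..L})"
  have t: "0 < t" "0 \<le> L" "t * L \<le> M" "decomposable {3} H" using assms(1) by (auto simp: scaling_step_def H_def)
  have un: "(*) t ` {-L..L} \<union> H = {-M..M}" using scaling_step_union[OF t(1-3)] by (simp add: H_def)
  have dis: "(*) t ` {-L..L} \<inter> H = {}" using scaling_step_disjoint[OF t(1)] by (simp add: H_def)
  have z: "0 \<notin> H" by (auto simp: H_def)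
  have "decomposable K ((*) t ` ({-L..L} - {0}) \<union> H)"
  proof (rule decomposable_Un)
    show "decomposable K ((*) t ` ({-L..L} - {0}))"
      using assms(3) t(1) by (intro decomposable_image) (auto simp: inj_on_def algebra_simps)
    show "decomposable K H" using t(4) by (rule decomposable_mono) (use assms(2) in simp)
    show "(*) t ` ({-L..L} - {0}) \<inter> H = {}" using dis by auto
  qed
  moreover have "(*) t ` ({-L..L} - {0}) \<union> H = {-M..M} - {0}"
    using t(1) z unfolding un[symmetric] by auto
  ultimately show ?thesis by simp
qed

text \<open>The second coordinate is stretched by \<open>t\<close>. The missing rows have heights in
  the remainder \<open>H\<close>, and \<open>decomposable_rows\<close> fills them.\<close>

lemma decomposable_punctured_box_step:
  assumes "scaling_step t L M" "3 \<in> K" "0 \<le> r" "decomposable K (punctured_box r L)"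
  shows "decomposable K (punctured_box r M)"
proof -
  define H where "H = ({1..M} - (*) t ` {1..L}) \<union> uminus ` ({1..M} - (*) t ` {1..L})"
  have t: "0 < t" "0 \<le> L" "t * L \<le> M" "decomposable {3} H" using assms(1) by (auto simp: scaling_step_def H_def)
  have un: "(*) t ` {-L..L} \<union> H = {-M..M}" using scaling_step_union[OF t(1-3)] by (simp add: H_def)
  have dis: "(*) t ` {-L..L} \<inter> H = {}" using scaling_step_disjoint[OF t(1)] by (simp add: H_def)
  have z: "0 \<notin> H" by (auto simp: H_def)
  let ?f = "\<lambda>(x::int, y). (x, t * y)"
  have "decomposable K (?f ` punctured_box r L \<union> {-r..r} \<times> H)"
  proof (rule decomposable_Un)
    show "decomposable K (?f ` punctured_box r L)"
      using assms(4) t(1) by (intro decomposable_image) (auto simp: inj_on_def algebra_simps)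
    show "decomposable K ({-r..r} \<times> H)"
      using decomposable_rows[OF t(4) assms(3)] by (rule decomposable_mono) (use assms(2) in simp)
    show "?f ` punctured_box r L \<inter> {-r..r} \<times> H = {}" using dis by (auto simp: punctured_box_def)
  qed
  moreover have "?f ` punctured_box r L = {-r..r} \<times> (*) t ` {-L..L} - {(0, 0)}"
    using t(1) by (force simp: punctured_box_def)
  moreover have "{-r..r} \<times> (*) t ` {-L..L} - {(0, 0)} \<union> {-r..r} \<times> H = punctured_box r M"
    using z unfolding punctured_box_def un[symmetric] by auto
  ultimately show ?thesis by simp
qed

section \<open>Boxes with n and m congruent to 1\<close>

lemma interval_symmetric: "{1..M} \<union> uminus ` {1..M} = {-M..M} - {0 :: int}"
proof (intro equalityI subsetI)
  fix x assume "x \<in> {-M..M} - {0}"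
  then have "x \<in> {1..M} \<or> - x \<in> {1..M}" by auto
  then show "x \<in> {1..M} \<union> uminus ` {1..M}" by (metis UnI1 UnI2 image_eqI minus_minus)
qed auto

text \<open>By \<open>k\<close> modulo 4, the right end is 12s, 12s + 3, 12s + 6 or 12s + 9. The
  first two reduce to 3s by stretching with 2, the others are direct.\<close>

lemma decomposable_interval: "decomposable {3, 4} ({- (3 * int k)..3 * int k} - {0})"
proof (induction k rule: less_induct)
  case (less k)
  \<comment> \<open>For k = 0 the first reduction would refer to itself, hence the separate
    case.\<close>
  have "k = 0 \<or> k = 4 * (k div 4) \<and> 0 < k div 4 \<or> k = 4 * (k div 4) + 1 \<or>
      k = 4 * (k div 4) + 2 \<or> k = 4 * (k div 4) + 3" by presburger
  then consider "k = 0" | s where "k = 4 * s" "0 < s" | s where "k = 4 * s + 1" |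
    s where "k = 4 * s + 2" | s where "k = 4 * s + 3"
    by blast
  then show ?case
  proof cases
    case 1
    then show ?thesis by (simp add: decomposable_empty)
  next
    case (2 s)
    then show ?thesis
      using decomposable_interval_step[OF scaling_step_quadruple[of "3 * int s"], of "{3, 4}"] less[of s] by simp
  next
    case (3 s)
    then show ?thesis
      using decomposable_interval_step[OF scaling_step_quadruple_plus_3[of "3 * int s"], of "{3, 4}"] less[of s]
      by (simp add: algebra_simps)
  next
    case (4 s)
    consider "s = 0" | "s = 1" | "2 \<le> int s" by linarith
    then show ?thesis
      using decomposable_interval_6[unfolded interval_symmetric] decomposable_interval_18[unfolded interval_symmetric]
        decomposable_interval_12_6[of "int s", unfolded interval_symmetric] 4
      by cases (simp_all add: algebra_simps)
  next
    case (5 s)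
    consider "s = 0" | "s = 1" | "2 \<le> int s" by linarith
    then show ?thesis
      using decomposable_interval_9[unfolded interval_symmetric] decomposable_interval_21[unfolded interval_symmetric]
        decomposable_interval_12_9[of "int s", unfolded interval_symmetric] 5
      by cases (simp_all add: algebra_simps)
  qed
qed

text \<open>The two punctured axes and their product partition the punctured box.\<close>

lemma decomposable_punctured_box_1_mod_3: "decomposable {3, 4} (punctured_box (3 * int k) (3 * int l))"
proof -
  let ?X = "{- (3 * int k)..3 * int k} - {0}" and ?Y = "{- (3 * int l)..3 * int l} - {0}"
  have "decomposable {3, 4} ((\<lambda>x. (x, 0 :: int)) ` ?X \<union> Pair (0 :: int) ` ?Y \<union> ?X \<times> ?Y)"
    by (intro decomposable_Un decomposable_image decomposable_Times decomposable_interval) (auto simp: inj_on_def)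
  also have "(\<lambda>x. (x, 0)) ` ?X \<union> Pair 0 ` ?Y \<union> ?X \<times> ?Y = punctured_box (3 * int k) (3 * int l)"
    by (auto simp: punctured_box_def)
  finally show ?thesis .
qed

section \<open>Boxes with n and m congruent to 0\<close>

lemma decomposable_punctured_boxI:
  assumes "0 \<le> r" "0 \<le> M" "\<And>B. B \<in> set Bs \<Longrightarrow> distinct B \<and> length B \<in> K"
    "list_all (\<lambda>x. list_all (\<lambda>y. (x, y) = (0, 0) \<or>
       list_ex (\<lambda>B. list_ex (\<lambda>p. list_ex (\<lambda>q. p - q = (x, y)) B) B) Bs) [-M..M]) [0..r]"
    "int (\<Sum>B\<leftarrow>Bs. weight B) = (2 * r + 1) * (2 * M + 1) - 1"
  shows "decomposable K (punctured_box r M)"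
proof (rule decomposableI[where Bs = Bs])
  \<comment> \<open>The half with nonnegative first coordinate is checked by evaluation; the other
    half follows by negation.\<close>
  have *: "\<exists>B\<in>set Bs. (x, y) \<in> Delta B" if xy: "(x, y) \<in> punctured_box r M" "0 \<le> x" for x y
  proof -
    have "x \<in> set [0..r]" "y \<in> set [-M..M]" "(x, y) \<noteq> (0, 0)" using xy by (auto simp: punctured_box_def)
    then obtain B p q where "B \<in> set Bs" "p \<in> set B" "q \<in> set B" "p - q = (x, y)"
      using assms(4) unfolding list_all_iff list_ex_iff by blast
    moreover have "p \<noteq> q"
      using \<open>p - q = (x, y)\<close> \<open>(x, y) \<noteq> (0, 0)\<close> by (auto simp: zero_prod_def)
    ultimately show ?thesis by (metis DeltaI)
  qed
  fix d assume d: "d \<in> punctured_box r M"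
  obtain x y where xy: "d = (x, y)" by (cases d)
  show "\<exists>B\<in>set Bs. d \<in> Delta B"
  proof (cases "0 \<le> x")
    case True
    then show ?thesis using * d xy by blast
  next
    case False
    then have "\<exists>B\<in>set Bs. (- x, - y) \<in> Delta B" using d xy by (intro *) (auto simp: punctured_box_def)
    then show ?thesis using Delta_uminus[of d] by (simp add: xy)
  qed
next
  show "(\<Sum>B\<leftarrow>Bs. weight B) \<le> card (punctured_box r M)" using assms(5) card_punctured_box[OF assms(1,2)] by linarith
qed (use assms finite_punctured_box in auto)

text \<open>This and the next two boxes are the base cases. Each takes one block of size 4 and
  otherwise triples: 24 = 12 + 2 * 6, 54 = 12 + 7 * 6, 120 = 12 + 18 * 6.\<close>

lemma decomposable_punctured_box_2_2: "decomposable {3, 4} (punctured_box 2 2)"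
  by (rule decomposable_punctured_boxI[where Bs = "[[(0, 1), (1, 0), (0, 0), (2, 2)], [(2, 0), (0, 2), (0, 0)], [(2, 1), (0, 2), (1, 0)]]"])
    (auto simp: weight_def upto_rec1 zero_prod_def)

lemma decomposable_punctured_box_2_5: "decomposable {3, 4} (punctured_box 2 5)"
  by (rule decomposable_punctured_boxI[where Bs = "[[(0, 3), (1, 0), (0, 1), (2, 3)], [(2, 3), (0, 5), (2, 0)],
      [(1, 2), (0, 4), (0, 0)], [(0, 0), (0, 1), (2, 4)], [(2, 4), (0, 5), (1, 0)], [(2, 1), (0, 4), (1, 0)],
      [(2, 1), (0, 5), (0, 0)], [(0, 0), (1, 0), (2, 5)]]"])
    (auto simp: weight_def upto_rec1 zero_prod_def)

lemma decomposable_punctured_box_5_5: "decomposable {3, 4} (punctured_box 5 5)"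
  by (rule decomposable_punctured_boxI[where Bs = "[[(0, 0), (0, 2), (3, 0), (0, 5)], [(5, 0), (0, 5), (3, 4)],
      [(5, 3), (0, 5), (4, 0)], [(4, 0), (0, 4), (0, 0)], [(5, 1), (0, 4), (5, 0)], [(0, 0), (2, 2), (5, 5)],
      [(5, 4), (3, 5), (0, 0)], [(0, 0), (2, 0), (4, 5)], [(5, 4), (0, 5), (1, 0)], [(4, 0), (0, 3), (3, 0)],
      [(5, 1), (3, 4), (0, 0)], [(5, 2), (4, 3), (0, 0)], [(4, 1), (1, 5), (0, 0)], [(2, 2), (0, 4), (1, 0)],
      [(5, 3), (1, 4), (0, 0)], [(0, 0), (1, 1), (3, 2)], [(3, 1), (2, 4), (0, 0)], [(5, 0), (4, 2), (0, 0)],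
      [(4, 3), (0, 5), (2, 0)]]"])
    (auto simp: weight_def upto_rec1 zero_prod_def)

text \<open>Half-widths 12s + 2 and 12s + 5 come down to 2 in one step; 12s + 8 = 4(3s + 2) and 12s
  + 11 = 4(3s + 2) + 3 come down to 3s + 2 by induction. Half-width 5 is a base case: removing 1, 2
  or 2, 4 from 1..5 leaves no triple a, b, a + b.\<close>

lemma decomposable_punctured_box_extend:
  assumes "0 \<le> r" "decomposable {3, 4} (punctured_box r 2)" "decomposable {3, 4} (punctured_box r 5)"
  shows "decomposable {3, 4} (punctured_box r (3 * int k + 2))"
proof (induction k rule: less_induct)
  case (less k)
  note ext = decomposable_punctured_box_step[of _ _ _ "{3, 4}" r, OF _ _ assms(1), simplified]
  have "k = 4 * (k div 4) \<or> k = 4 * (k div 4) + 1 \<or> k = 4 * (k div 4) + 2 \<or> k = 4 * (k div 4) + 3"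
    by presburger
  then consider s where "k = 4 * s" | s where "k = 4 * s + 1" |
    s where "k = 4 * s + 2" | s where "k = 4 * s + 3"
    by blast
  then show ?case
  proof cases
    case (1 s)
    \<comment> \<open>Half-widths 2, 14, 26 and 38 lie below the general family.\<close>
    consider "s = 0" | "s = 1" | "s = 2" | "s = 3" | "4 \<le> int s" by linarith
    then show ?thesis
      using 1 assms(2) ext[OF scaling_step_14] ext[OF scaling_step_26] ext[OF scaling_step_38]
        ext[OF scaling_step_12_2[of "int s"]]
      by cases (simp_all add: algebra_simps)
  next
    case (2 s)
    consider "s = 0" | "s = 1" | "s = 2" | "3 \<le> int s" by linarith
    then show ?thesis
      using 2 assms(2,3) ext[OF scaling_step_17] ext[OF scaling_step_29] ext[OF scaling_step_12_5[of "int s"]]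
      by cases (simp_all add: algebra_simps)
  next
    case (3 s)
    then show ?thesis
      using ext[OF scaling_step_quadruple[of "3 * int s + 2"]] less[of s] by (simp add: algebra_simps)
  next
    case (4 s)
    then show ?thesis
      using ext[OF scaling_step_quadruple_plus_3[of "3 * int s + 2"]] less[of s] by (simp add: algebra_simps)
  qed
qed

text \<open>The boxes of half-width 2 and 5 are lengthened in one direction; after a swap they are
  the two base cases for the other direction.\<close>

lemma decomposable_punctured_box_0_mod_3: "decomposable {3, 4} (punctured_box (3 * int k + 2) (3 * int l + 2))"
proof -
  have "decomposable {3, 4} (punctured_box 2 (3 * int k + 2))"
    by (rule decomposable_punctured_box_extend[OF _ decomposable_punctured_box_2_2 decomposable_punctured_box_2_5]) simp
  moreover have "decomposable {3, 4} (punctured_box 5 (3 * int k + 2))"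
    by (rule decomposable_punctured_box_extend[OF _ decomposable_punctured_box_swap[OF decomposable_punctured_box_2_5] decomposable_punctured_box_5_5]) simp
  ultimately show ?thesis
    by (intro decomposable_punctured_box_extend) (auto dest: decomposable_punctured_box_swap)
qed

section \<open>From decompositions to codes\<close>

lemma pair_differences:
  fixes B :: "(int \<times> int) set"
  shows "differences B = image_mset (\<lambda>(p, q). p - q) (mset_set {(p, q). p \<in> B \<and> q \<in> B \<and> p \<noteq> q})"
  unfolding differences_def by (intro image_mset_cong) (auto split: prod.splits)

lemma card_pairs:
  assumes "finite B"
  shows "card {(p, q). p \<in> B \<and> q \<in> B \<and> p \<noteq> q} = card B * (card B - 1)"
proof -
  have "{(p, q). p \<in> B \<and> q \<in> B \<and> p \<noteq> q} = (SIGMA p:B. B - {p})" by auto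
  then show ?thesis using assms by simp
qed

lemma size_differences: "finite B \<Longrightarrow> size (differences B) = card B * (card B - 1)"
  by (simp add: differences_def card_pairs)

text \<open>With the sum of multisets written as one image of a set of triples (B, p, q),
  multiplicity one becomes injectivity of the difference map.\<close>

lemma code_differences_eq:
  assumes "finite C" "\<And>B. B \<in> C \<Longrightarrow> finite B"
  shows "code_differences C =
    image_mset (\<lambda>(B, p, q). p - q) (mset_set (SIGMA B:C. {(p, q). p \<in> B \<and> q \<in> B \<and> p \<noteq> q}))"
  using assms
proof (induction C rule: finite_induct)
  case empty
  then show ?case by (simp add: code_differences_def)
next
  case (insert A C)
  let ?P = "\<lambda>B. {(p, q). p \<in> B \<and> q \<in> B \<and> p \<noteq> q}"
  have fin: "finite (?P B)" if "B \<in> insert A C" for B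
    using insert.prems[OF that] by (intro finite_subset[of "?P B" "B \<times> B"]) auto
  have "Sigma (insert A C) ?P = Pair A ` ?P A \<union> Sigma C ?P" by auto
  moreover have "Pair A ` ?P A \<inter> Sigma C ?P = {}" using insert.hyps(2) by auto
  ultimately have "mset_set (Sigma (insert A C) ?P) = mset_set (Pair A ` ?P A) + mset_set (Sigma C ?P)"
    using fin insert.hyps(1) by (simp add: mset_set_Union)
  moreover have "mset_set (Pair A ` ?P A) = image_mset (Pair A) (mset_set (?P A))"
    by (simp add: image_mset_mset_set inj_on_def)
  ultimately show ?case
    using insert by (simp add: code_differences_def pair_differences image_mset.compositionality o_def)
qed

text \<open>Two common points of \<open>A\<close> and a translate of \<open>B\<close> yield pairs in
  \<open>A\<close> and in \<open>B\<close> with the same difference. Injectivity then gives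
  \<open>A = B\<close> and the zero translation, so both correlation conditions follow.\<close>

lemma perfect_gocI:
  assumes "0 < n" "0 < m" "\<And>k. k \<in> K \<Longrightarrow> 0 < k" "finite C"
    and within: "\<And>B. B \<in> C \<Longrightarrow> B \<subseteq> {0..<int n} \<times> {0..<int m}"
    and card: "\<And>B. B \<in> C \<Longrightarrow> card B \<in> K"
    and inj: "inj_on (\<lambda>(B, p, q). p - q) (SIGMA B:C. {(p, q). p \<in> B \<and> q \<in> B \<and> p \<noteq> q})"
    and image: "(\<lambda>(B, p, q). p - q) ` (SIGMA B:C. {(p, q). p \<in> B \<and> q \<in> B \<and> p \<noteq> q}) =
      centered_interval (2 * int n - 1) \<times> centered_interval (2 * int m - 1) - {(0, 0)}"
  shows "perfect_goc n m K C"
proof -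
  have fin: "finite B" if "B \<in> C" for B using within[OF that] by (rule finite_subset) simp
  have uniq: "A = B \<and> v = (0, 0)" if AB: "A \<in> C" "B \<in> C" "\<not> card (A \<inter> translate B v) \<le> 1" for A B v
  proof -
    have "finite (A \<inter> translate B v)" using fin AB(1) by simp
    then obtain p q where pq: "p \<noteq> q" "p \<in> A \<inter> translate B v" "q \<in> A \<inter> translate B v"
      using AB(3) card_le_Suc0_iff_eq[of "A \<inter> translate B v"] by auto
    obtain p' q' where p'q': "p' \<in> B" "q' \<in> B" "p = p' + v" "q = q' + v"
      using pq(2,3) unfolding translate_def by (cases v) (auto simp: plus_prod_def)
    have "(A, p, q) = (B, p', q')"
      using pq p'q' AB(1,2) by (intro inj_onD[OF inj]) auto
    then show ?thesis using p'q' by (auto simp: zero_prod_def)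
  qed
  have "code_differences C = mset_set (centered_interval (2 * int n - 1) \<times> centered_interval (2 * int m - 1) - {(0, 0)})"
    using assms(4) fin inj by (simp add: code_differences_eq image_mset_mset_set image)
  moreover have "geometric_orthogonal_code n m K C"
    unfolding geometric_orthogonal_code_def using assms(1-3) within card uniq by blast
  ultimately show ?thesis by (simp add: perfect_goc_def)
qed

lemma centered_interval_odd: "0 < n \<Longrightarrow> centered_interval (2 * int n - 1) = {- (int n - 1)..int n - 1}"
  by (auto simp: centered_interval_def)

lemma Delta_shift: "Delta (map (\<lambda>p. p - v) B) = Delta B"
proof -
  have *: "Delta C \<subseteq> Delta (map (\<lambda>p. p - w) C)" for w C
  proof
    fix d assume "d \<in> Delta C"
    then obtain p q where "p \<in> set C" "q \<in> set C" "p \<noteq> q" "d = p - q" by (auto simp: Delta_def)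
    then show "d \<in> Delta (map (\<lambda>p. p - w) C)" by (intro DeltaI2[of "p - w" _ "q - w"]) auto
  qed
  from *[of "map (\<lambda>p. p - v) B" "- v"] *[of B v] show ?thesis by (simp add: o_def)
qed

text \<open>The differences of the code cover the punctured box, and its pairs are at most as many
  as the box has elements. So the difference map is injective and its image is exactly the
  box.\<close>

lemma perfect_goc_if_decomposable:
  assumes n: "0 < n" and m: "0 < m" and decomposable: "decomposable {3, 4} (punctured_box (int n - 1) (int m - 1))"
  shows "\<exists>C. perfect_goc n m {3, 4} C"
proof -
  let ?D = "punctured_box (int n - 1) (int m - 1)"
  obtain Bs where "finite ?D" and Bs: "\<And>B. B \<in> set Bs \<Longrightarrow> distinct B \<and> length B \<in> {3, 4}"
    "\<And>d. d \<in> ?D \<Longrightarrow> \<exists>B\<in>set Bs. d \<in> Delta B" "(\<Sum>B\<leftarrow>Bs. weight B) \<le> card ?D"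
    using decomposableE[OF decomposable] by blast
  \<comment> \<open>Every block is moved so that its smallest coordinates are both 0; its
    differences do not change.\<close>
  define corner where "corner B = (Min (fst ` set B), Min (snd ` set B))" for B :: "(int \<times> int) list"
  define E where "E B = map (\<lambda>p. p - corner B) B" for B
  define C where "C = (\<lambda>B. set (E B)) ` set Bs"
  let ?P = "\<lambda>B. {(p, q). p \<in> B \<and> q \<in> B \<and> p \<noteq> q}"
  let ?f = "\<lambda>(B, p, q). p - q :: int \<times> int"
  have E: "distinct (E B)" "length (E B) \<in> {3, 4}" if "B \<in> set Bs" for B
    using Bs(1)[OF that] by (auto simp: E_def distinct_map inj_on_def)
  have finC: "finite C" "\<And>B. B \<in> C \<Longrightarrow> finite B" by (auto simp: C_def)
  have finP: "finite (?P B)" if "B \<in> C" for B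
    using finC(2)[OF that] by (intro finite_subset[of "?P B" "B \<times> B"]) auto
  have "card (Sigma C ?P) = (\<Sum>B\<in>C. card B * (card B - 1))"
    using finC finP by (simp add: card_SigmaI card_pairs)
  \<comment> \<open>Different blocks may fall together in \<open>C\<close>; this can only lower the
    count.\<close>
  also have "\<dots> \<le> (\<Sum>B\<in>set Bs. card (set (E B)) * (card (set (E B)) - 1))"
    unfolding C_def by (rule sum_image_le[of _ "\<lambda>B. card B * (card B - 1)", unfolded o_def]) auto
  also have "\<dots> = (\<Sum>B\<in>set Bs. weight B)"
    using distinct_card[OF E(1)] by (intro sum.cong refl) (simp add: weight_def E_def)
  also have "\<dots> \<le> (\<Sum>B\<leftarrow>Bs. weight B)"
    by (induction Bs) (auto simp: sum.insert_if)
  also note Bs(3)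
  finally have le: "card (Sigma C ?P) \<le> card ?D" .
  have sub: "?D \<subseteq> ?f ` Sigma C ?P"
  proof
    fix d assume "d \<in> ?D"
    then obtain B where B: "B \<in> set Bs" "d \<in> Delta (E B)"
      using Bs(2)[of d] unfolding E_def Delta_shift by blast
    then obtain p q where "p \<in> set (E B)" "q \<in> set (E B)" "p \<noteq> q" "d = p - q"
      by (auto simp: Delta_def)
    with B(1) show "d \<in> ?f ` Sigma C ?P"
      by (intro image_eqI[of _ _ "(set (E B), p, q)"]) (auto simp: C_def)
  qed
  have fin: "finite (Sigma C ?P)" using finC finP by (intro finite_SigmaI) auto
  have le': "card (?f ` Sigma C ?P) \<le> card (Sigma C ?P)" using fin by (rule card_image_le)
  have fin': "finite (?f ` Sigma C ?P)" using fin by simp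
  have "card ?D \<le> card (?f ` Sigma C ?P)" using fin' sub by (rule card_mono)
  then have eq: "card ?D = card (?f ` Sigma C ?P)" "card (?f ` Sigma C ?P) = card (Sigma C ?P)"
    using le le' by linarith+
  have image: "?f ` Sigma C ?P = ?D" using card_subset_eq[OF fin' sub eq(1)] by (rule sym)
  have inj: "inj_on ?f (Sigma C ?P)" using fin eq(2) by (rule eq_card_imp_inj_on)
  have "perfect_goc n m {3, 4} C"
  proof (rule perfect_gocI[OF n m _ finC(1) _ _ inj])
    show "?f ` Sigma C ?P = centered_interval (2 * int n - 1) \<times> centered_interval (2 * int m - 1) - {(0, 0)}"
      using n m by (simp add: image centered_interval_odd punctured_box_def)
  next
    fix A assume "A \<in> C"
    then obtain B where B: "B \<in> set Bs" "A = set (E B)" by (auto simp: C_def)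
    then show "card A \<in> {3, 4}" using E[of B] distinct_card[of "E B"] by simp
    have B0: "set B \<noteq> {}" using Bs(1)[OF B(1)] by auto
    show "A \<subseteq> {0..<int n} \<times> {0..<int m}"
    proof
      fix p assume "p \<in> A"
      then obtain x y where xy: "(x, y) \<in> set B" "p = (x, y) - corner B" using B by (auto simp: E_def)
      \<comment> \<open>The two minima may be attained at different points, so each coordinate is
        bounded by its own difference in \<open>?D\<close>.\<close>
      have "Min (fst ` set B) \<in> fst ` set B" "Min (snd ` set B) \<in> snd ` set B"
        using B0 by (auto intro: Min_in)
      then obtain y' x' where c: "(Min (fst ` set B), y') \<in> set B" "(x', Min (snd ` set B)) \<in> set B"
        by auto
      have D: "r \<in> set B \<Longrightarrow> s \<in> set B \<Longrightarrow> r - s \<in> ?D \<or> r = s" for r s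
      proof (rule disjCI)
        assume "r \<in> set B" "s \<in> set B" "r \<noteq> s"
        then have "?f (A, r - corner B, s - corner B) \<in> ?f ` Sigma C ?P"
          using \<open>A \<in> C\<close> B(2) by (intro imageI) (auto simp: E_def)
        then show "r - s \<in> ?D" unfolding image by simp
      qed
      have "x - Min (fst ` set B) \<le> int n - 1" "y - Min (snd ` set B) \<le> int m - 1"
        using D[OF xy(1) c(1)] D[OF xy(1) c(2)] n m by (auto simp: punctured_box_def)
      moreover have "Min (fst ` set B) \<le> x" "Min (snd ` set B) \<le> y"
        using xy(1) by (auto intro!: Min_le simp: rev_image_eqI)
      ultimately show "p \<in> {0..<int n} \<times> {0..<int m}" using xy(2) by (simp add: corner_def)
    qed
  qed auto
  then show ?thesis ..
qed

section \<open>Necessity of the congruences\<close>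

lemma perfect_goc_imp_mod_3:
  assumes "perfect_goc n m {3, 4} C"
  shows "([n = 0] (mod 3) \<and> [m = 0] (mod 3)) \<or> ([n = 1] (mod 3) \<and> [m = 1] (mod 3))"
proof -
  have pos: "0 < n" "0 < m" and B: "\<And>B. B \<in> C \<Longrightarrow> B \<subseteq> {0..<int n} \<times> {0..<int m} \<and> card B \<in> {3, 4}"
    and D: "code_differences C =
      mset_set (centered_interval (2 * int n - 1) \<times> centered_interval (2 * int m - 1) - {(0, 0)})"
    using assms unfolding perfect_goc_def geometric_orthogonal_code_def by auto
  have "finite C" using B by (intro finite_subset[of C "Pow ({0..<int n} \<times> {0..<int m})"]) auto
  then have "size (code_differences C) = (\<Sum>B\<in>C. size (differences B))"
    unfolding code_differences_def by (induction C rule: finite_induct) auto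
  moreover have "6 dvd size (differences B)" if "B \<in> C" for B
  proof -
    have "finite B" using B[OF that] by (intro finite_subset[of B "{0..<int n} \<times> {0..<int m}"]) auto
    then show ?thesis using B[OF that] by (auto simp: size_differences)
  qed
  ultimately have "6 dvd size (code_differences C)" by (simp add: dvd_sum)
  also have "size (code_differences C) = card (punctured_box (int n - 1) (int m - 1))"
    unfolding D using pos by (simp add: centered_interval_odd punctured_box_def)
  finally have "6 dvd int (card (punctured_box (int n - 1) (int m - 1)))" by presburger
  then have "6 dvd (2 * int n - 1) * (2 * int m - 1) - 1"
    using pos by (simp add: card_punctured_box algebra_simps)
  then obtain k where "(2 * int n - 1) * (2 * int m - 1) - 1 = 6 * k" by (elim dvdE)
  \<comment> \<open>The left side is (2n - 1)(2m - 1) - 1 = 2(2nm - n - m).\<close>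
  then have k: "2 * int n * int m - int n - int m = 3 * k" by (simp add: algebra_simps)
  define a b where "a = n mod 3" and "b = m mod 3"
  have "int n = 3 * int (n div 3) + int a" "int m = 3 * int (m div 3) + int b"
    unfolding a_def b_def by presburger+
  then have "2 * int a * int b - int a - int b =
      3 * (k - 6 * int (n div 3) * int (m div 3) - 2 * int (n div 3) * int b - 2 * int a * int (m div 3)
        + int (n div 3) + int (m div 3))"
    using k by (simp add: algebra_simps)
  then have "3 dvd 2 * int a * int b - int a - int b" by (metis dvd_triv_left)
  moreover have "a = 0 \<or> a = 1 \<or> a = 2" "b = 0 \<or> b = 1 \<or> b = 2" unfolding a_def b_def by linarith+
  \<comment> \<open>Of the nine pairs of residues, only (0, 0) and (1, 1) make 2ab - a - b divisible
    by 3; for (2, 2) it is 4.\<close>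
  ultimately have "a = 0 \<and> b = 0 \<or> a = 1 \<and> b = 1" by auto
  then show ?thesis by (simp add: a_def b_def cong_def)
qed

theorem theorem6p2:
  fixes n m :: nat
  assumes "0 < n" and "0 < m"
  shows "(\<exists>C. variable_weight {3, 4} \<and> perfect_goc n m {3, 4} C) \<longleftrightarrow>
    ([n = 0] (mod 3) \<and> [m = 0] (mod 3)) \<or> ([n = 1] (mod 3) \<and> [m = 1] (mod 3))"
    (is "?L \<longleftrightarrow> ?R")
proof
  assume ?L
  then show ?R using perfect_goc_imp_mod_3 by blast
next
  assume ?R
  then have "decomposable {3, 4} (punctured_box (int n - 1) (int m - 1))"
  proof (elim disjE conjE)
    assume "[n = 0] (mod 3)" "[m = 0] (mod 3)"
    then obtain k l where "n = 3 * k" "m = 3 * l" by (auto simp: cong_0_iff elim!: dvdE)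
    \<comment> \<open>\<open>n\<close> is positive, so \<open>k \<ge> 1\<close> and n - 1 = 3(k - 1)
      + 2; likewise for \<open>m\<close>.\<close>
    moreover from this have "int n - 1 = 3 * int (k - 1) + 2" "int m - 1 = 3 * int (l - 1) + 2"
      using assms by auto
    ultimately show ?thesis using decomposable_punctured_box_0_mod_3[of "k - 1" "l - 1"] by (simp only:)
  next
    assume "[n = 1] (mod 3)" "[m = 1] (mod 3)"
    then have "n mod 3 = 1" "m mod 3 = 1" by (simp_all add: cong_def)
    then have "int n - 1 = 3 * int (n div 3)" "int m - 1 = 3 * int (m div 3)" by presburger+
    then show ?thesis using decomposable_punctured_box_1_mod_3[of "n div 3" "m div 3"] by simp
  qed
  then obtain C where "perfect_goc n m {3, 4} C" using perfect_goc_if_decomposable assms by blast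
  moreover have "variable_weight {3, 4}" by (auto simp: variable_weight_def)
  ultimately show ?L by blast
qed

end
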